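(* Let $G$ be an unweighted graph without isolated vertices, and put $n=|V(G)|$. Then $G$ is antimagic if and only if there exists a polynomial $$p\in s\left(I(G)*C(1,\dots,|E(G)|)_{n}*\left(S[x]+x^{n}E[x]\right)\right)$$ such that the coefficients $\mathrm{coef}_j(p)$ for $j\in\{0,\dots,n-1\}$ are pairwise different and the remaining coefficients of $p$ form a set $A$ with $A\supseteq\{1,2,\dots,|E(G)|\}$.
   Context: Graphs are finite, simple, and have at least one vertex. A graph $G$ without isolated vertices is antimagic if there is a bijection $\ell\colon E(G)\to\{1,2,\dots,|E(G)|\}$ such that the weighted degrees $w(u)=\sum_{\{u,v\}\in E(G)}\ell(\{u,v\})$, $u\in V(G)$, are pairwise different. For a commutative ring $R$, an $R$-weighted complete graph $G$ is a complete graph on a finite vertex set $V(G)$ with a weight function $\nu_G$ from the set of all 2-element subsets of $V(G)$ to $R$. Weights in a subring are regarded as weights in the larger ring; here everything may be taken over $\mathbb{R}[x]$. If $H,G$ are $R$-weighted complete graphs with $|V(H)|=|V(G)|$ and $f\colon V(H)\to V(G)$ is a bijection, $H*_fG$ is the $R$-weighted complete graph on $V(H)$ with $\nu_{H*_fG}(e)=\nu_H(e)\cdot\nu_G(f(e))$, where $f(\{a,b\})=\{f(a),f(b)\}$. Put $H*G=\{H*_fG : f\colon V(H)\to V(G)\text{ a bijection}\}$, and for sets $\mathscr{H},\mathscr{G}$ of $R$-weighted complete graphs of the same order $\mathscr{H}*\mathscr{G}=\bigcup_{H\in\mathscr{H},\,G\in\mathscr{G}}H*G$. A single graph is identified with the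 corresponding singleton. The operation $*$ on sets is associative. For an $R$-weighted complete graph $G$, $s(G)=\sum_e\nu_G(e)$ (sum over all 2-element subsets $e$ of $V(G)$), and $s(\mathscr{G})=\{s(G):G\in\mathscr{G}\}$. Weighted complete graphs on the same vertex set are added and multiplied by scalars edgewise: $\nu_{H_1+H_2}(e)=\nu_{H_1}(e)+\nu_{H_2}(e)$, $\nu_{rH}(e)=r\,\nu_H(e)$; for sets, $\mathscr{H}_1+\mathscr{H}_2=\{H_1+H_2: H_1\in\mathscr{H}_1,H_2\in\mathscr{H}_2\}$. For an unweighted graph $G$, $I(G)$ is the weighted complete graph on $V(G)$ with weight $1$ on edges of $G$ and $0$ on non-edges. Let $n=|V(G)|$. For $j\in\{1,\dots,n\}$, $S(j)$ is the star with center $j$ on the vertex set $\{1,\dots,n\}$; for distinct $j,k\in\{1,\dots,n\}$, $E(j,k)$ is the graph on $\{1,\dots,n\}$ whose only edge is $\{j,k\}$. Define $$S[x]=\sum_{j=1}^{n}x^{j-1}\cdot I(S(j)),\qquad E[x]=\sum_{1\le k<j\le n}x^{\psi(j,k)}\cdot I(E(j,k)),\qquad \psi(j,k)=\binom{j-1}{2}+k-1 .$$ For a set $\mathscr{G}$ of weighted complete graphs of order $n$, $\mathscr{G}^{*m}$ is the $m$-fold product $\mathscr{G}*\cdots*\mathscr{G}$; if there is $m_0$ with $\mathscr{G}^{*m}=\mathscr{G}^{*m_0}$ for all $m\ge m_0$, then $\mathscr{G}^{*\infty}=\mathscr{G}^{*m_0}$; and $G^{*\infty}=\{G\}^{*\infty}$.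 Let $K_n$ be the complete graph on $\{1,\dots,n\}$ and $K_n\setminus e$ the graph $K_n$ with one (arbitrary fixed) edge $e$ removed. For $k\ge1$, $$C(1,\dots,k)_n=\sum_{i=1}^{k-1}\left(I(K_n\setminus e)^{*\infty}\cup\{I(K_n)\}\right)+I(K_n),$$ a sum of sets in the sense $\mathscr{H}_1+\mathscr{H}_2=\{H_1+H_2: H_1\in\mathscr{H}_1,H_2\in\mathscr{H}_2\}$, with $H_1+H_2$ the edgewise sum (for $k=1$ it is $\{I(K_n)\}$). $\mathrm{coef}_j(p)$ is the coefficient of $x^j$ in $p$. *)

theory Defs
  imports
    "HOL-Library.Ramsey"
    "HOL-Library.FuncSet"
    "HOL-Computational_Algebra.Polynomial"
begin

text \<open>
  The set of 2-element subsets of \<open>V\<close> is written \<open>[V]\<^bsup>2\<^esup>\<close>, i.e. \<open>nsets V 2\<close>.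
\<close>

record 'a graph =
  verts :: "'a set"
  edges :: "'a set set"

definition simple_graph :: "'a graph \<Rightarrow> bool" where
  "simple_graph G \<longleftrightarrow> finite (verts G) \<and> verts G \<noteq> {} \<and> edges G \<subseteq> [verts G]\<^bsup>2\<^esup>"

definition no_isolated_verts :: "'a graph \<Rightarrow> bool" where
  "no_isolated_verts G \<longleftrightarrow> (\<forall>v\<in>verts G. \<exists>e\<in>edges G. v \<in> e)"

definition weighted_degree :: "'a graph \<Rightarrow> ('a set \<Rightarrow> nat) \<Rightarrow> 'a \<Rightarrow> nat" where
  "weighted_degree G l u = (\<Sum>e\<in>{e \<in> edges G. u \<in> e}. l e)"

definition antimagic :: "'a graph \<Rightarrow> bool" where
  "antimagic G \<longleftrightarrow>
     (\<exists>l. bij_betw l (edges G) {1..card (edges G)} \<and> inj_on (weighted_degree G l) (verts G))"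

text \<open>
  A weighted complete graph consists of a finite vertex set \<open>V\<close> and a function on \<open>[V]\<^bsup>2\<^esup>\<close>. Such
  functions are represented by extensional ones (equal to \<open>undefined\<close> outside \<open>[V]\<^bsup>2\<^esup>\<close>), so that
  equality of weighted complete graphs is equality of records. This matters for equality of sets
  of weighted complete graphs, in particular for stabilisation of iterated products. All
  operations below restrict their result accordingly.
\<close>

record ('a, 'r) wgraph =
  wverts :: "'a set"
  weight :: "'a set \<Rightarrow> 'r"

definition wf_wgraph :: "('a, 'r) wgraph \<Rightarrow> bool" where
  "wf_wgraph G \<longleftrightarrow> finite (wverts G) \<and> weight G \<in> extensional ([wverts G]\<^bsup>2\<^esup>)"

definition mk_wgraph :: "'a set \<Rightarrow> ('a set \<Rightarrow> 'r) \<Rightarrow> ('a, 'r) wgraph" where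
  "mk_wgraph V w = \<lparr>wverts = V, weight = restrict w ([V]\<^bsup>2\<^esup>)\<rparr>"

definition wgraph_of :: "'a graph \<Rightarrow> ('a, 'r::comm_ring_1) wgraph" where
  "wgraph_of G = mk_wgraph (verts G) (\<lambda>e. if e \<in> edges G then 1 else 0)"

definition star_via ::
  "('a, 'r::comm_ring_1) wgraph \<Rightarrow> ('a \<Rightarrow> 'b) \<Rightarrow> ('b, 'r) wgraph \<Rightarrow> ('a, 'r) wgraph" where
  "star_via H f G = mk_wgraph (wverts H) (\<lambda>e. weight H e * weight G (f ` e))"

definition star ::
  "('a, 'r::comm_ring_1) wgraph set \<Rightarrow> ('b, 'r) wgraph set \<Rightarrow> ('a, 'r) wgraph set"
  (infixl \<open>\<star>\<close> 70) where
  "\<H> \<star> \<G> = {star_via H f G | H f G. H \<in> \<H> \<and> G \<in> \<G> \<and> bij_betw f (wverts H) (wverts G)}"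

text \<open>The \<open>m\<close>-fold product \<open>\<G> \<star> \<dots> \<star> \<G>\<close>, meaningful for \<open>m \<ge> 1\<close>.\<close>

definition star_power :: "('a, 'r::comm_ring_1) wgraph set \<Rightarrow> nat \<Rightarrow> ('a, 'r) wgraph set" where
  "star_power \<G> m = ((\<lambda>\<H>. \<H> \<star> \<G>) ^^ (m - 1)) \<G>"

definition star_inf :: "('a, 'r::comm_ring_1) wgraph set \<Rightarrow> ('a, 'r) wgraph set" where
  "star_inf \<G> = (THE \<L>. \<exists>m0\<ge>1. \<L> = star_power \<G> m0 \<and>
      (\<forall>m\<ge>m0. star_power \<G> m = star_power \<G> m0))"

definition total_weight :: "('a, 'r::comm_ring_1) wgraph \<Rightarrow> 'r" where
  "total_weight G = (\<Sum>e\<in>[wverts G]\<^bsup>2\<^esup>. weight G e)"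

definition wadd ::
  "('a, 'r::comm_ring_1) wgraph \<Rightarrow> ('a, 'r) wgraph \<Rightarrow> ('a, 'r) wgraph" where
  "wadd H1 H2 = mk_wgraph (wverts H1) (\<lambda>e. weight H1 e + weight H2 e)"

definition wscale :: "'r::comm_ring_1 \<Rightarrow> ('a, 'r) wgraph \<Rightarrow> ('a, 'r) wgraph" where
  "wscale r H = mk_wgraph (wverts H) (\<lambda>e. r * weight H e)"

text \<open>Edgewise sum of a finite family of weighted complete graphs on the vertex set \<open>V\<close>.\<close>

definition wsum ::
  "'a set \<Rightarrow> ('i \<Rightarrow> ('a, 'r::comm_ring_1) wgraph) \<Rightarrow> 'i set \<Rightarrow> ('a, 'r) wgraph" where
  "wsum V F J = mk_wgraph V (\<lambda>e. \<Sum>i\<in>J. weight (F i) e)"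

definition wadd_set ::
  "('a, 'r::comm_ring_1) wgraph set \<Rightarrow> ('a, 'r) wgraph set \<Rightarrow> ('a, 'r) wgraph set" where
  "wadd_set \<H>1 \<H>2 = {wadd H1 H2 | H1 H2. H1 \<in> \<H>1 \<and> H2 \<in> \<H>2 \<and> wverts H1 = wverts H2}"

definition star_graph :: "nat \<Rightarrow> nat \<Rightarrow> nat graph" where
  "star_graph n j = \<lparr>verts = {1..n}, edges = {{j, k} | k. k \<in> {1..n} \<and> k \<noteq> j}\<rparr>"

definition edge_graph :: "nat \<Rightarrow> nat \<Rightarrow> nat \<Rightarrow> nat graph" where
  "edge_graph n j k = \<lparr>verts = {1..n}, edges = {{j, k}}\<rparr>"

definition psi :: "nat \<Rightarrow> nat \<Rightarrow> nat" where
  "psi j k = ((j - 1) choose 2) + k - 1"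

definition S_poly :: "nat \<Rightarrow> (nat, real poly) wgraph" where
  "S_poly n = wsum {1..n} (\<lambda>j. wscale (monom 1 (j - 1)) (wgraph_of (star_graph n j))) {1..n}"

definition E_poly :: "nat \<Rightarrow> (nat, real poly) wgraph" where
  "E_poly n = wsum {1..n} (\<lambda>(j, k). wscale (monom 1 (psi j k)) (wgraph_of (edge_graph n j k)))
     {(j, k). 1 \<le> k \<and> k < j \<and> j \<le> n}"

definition complete_graph :: "nat \<Rightarrow> nat graph" where
  "complete_graph n = \<lparr>verts = {1..n}, edges = [{1..n}]\<^bsup>2\<^esup>\<rparr>"

definition remove_edge :: "'a graph \<Rightarrow> 'a set \<Rightarrow> 'a graph" where
  "remove_edge G e = \<lparr>verts = verts G, edges = edges G - {e}\<rparr>"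

text \<open>
  \<open>C_set e k n\<close> is \<open>C(1,\<dots>,k)\<^sub>n\<close> for \<open>k \<ge> 1\<close>, formed with the removed edge \<open>e\<close> of \<open>K\<^sub>n\<close>: the sum of
  \<open>k - 1\<close> copies of \<open>I(K\<^sub>n \<setminus> e)\<^sup>*\<^sup>\<infinity> \<union> {I(K\<^sub>n)}\<close> and of \<open>{I(K\<^sub>n)}\<close>.
\<close>

definition C_set :: "nat set \<Rightarrow> nat \<Rightarrow> nat \<Rightarrow> (nat, 'r::comm_ring_1) wgraph set" where
  "C_set e k n =
     (wadd_set (star_inf {wgraph_of (remove_edge (complete_graph n) e)}
                \<union> {wgraph_of (complete_graph n)}) ^^ (k - 1))
       {wgraph_of (complete_graph n)}"

lemma wverts_mk_wgraph [simp]: "wverts (mk_wgraph V w) = V"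
  by (simp add: mk_wgraph_def)

lemma weight_mk_wgraph [simp]: "e \<in> [V]\<^bsup>2\<^esup> \<Longrightarrow> weight (mk_wgraph V w) e = w e"
  by (simp add: mk_wgraph_def)

lemma wf_mk_wgraph [simp]: "wf_wgraph (mk_wgraph V w) \<longleftrightarrow> finite V"
  by (simp add: mk_wgraph_def wf_wgraph_def)

lemma mk_wgraph_cong:
  assumes "\<And>e. e \<in> [V]\<^bsup>2\<^esup> \<Longrightarrow> w e = w' e"
  shows "mk_wgraph V w = mk_wgraph V w'"
  using assms by (auto simp: mk_wgraph_def restrict_def)

lemma image_in_nsets2:
  assumes "bij_betw f V W" "e \<in> [V]\<^bsup>2\<^esup>"
  shows "f ` e \<in> [W]\<^bsup>2\<^esup>"
proof -
  from assms have "inj_on f e" "f ` V = W" "e \<subseteq> V" "finite e" "card e = 2"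
    by (auto simp: bij_betw_def nsets_def intro: inj_on_subset)
  then show ?thesis
    by (auto simp: nsets_def card_image)
qed

lemma wverts_star_via [simp]: "wverts (star_via H f G) = wverts H"
  by (simp add: star_via_def)

lemma starI:
  "\<lbrakk>H \<in> \<H>; G \<in> \<G>; bij_betw f (wverts H) (wverts G)\<rbrakk> \<Longrightarrow> star_via H f G \<in> \<H> \<star> \<G>"
  by (auto simp: star_def)

lemma star_via_assoc:
  assumes "bij_betw f (wverts H) (wverts G)"
  shows "star_via (star_via H f G) (g \<circ> f) K = star_via H f (star_via G g K)"
  unfolding star_via_def wverts_mk_wgraph
  by (rule mk_wgraph_cong) (simp add: image_in_nsets2[OF assms] image_comp mult.assoc)

lemma star_assoc: "(\<H> \<star> \<G>) \<star> \<K> = \<H> \<star> (\<G> \<star> \<K>)"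
proof (intro equalityI subsetI)
  fix X assume "X \<in> (\<H> \<star> \<G>) \<star> \<K>"
  then obtain H f G h K where *: "H \<in> \<H>" "G \<in> \<G>" "K \<in> \<K>" "bij_betw f (wverts H) (wverts G)"
      "bij_betw h (wverts H) (wverts K)" "X = star_via (star_via H f G) h K"
    unfolding star_def by (auto simp: star_via_def)
  let ?f' = "inv_into (wverts H) f"
  let ?g = "h \<circ> ?f'"
  have g: "bij_betw ?g (wverts G) (wverts K)"
    using *(4,5) by (blast intro: bij_betw_trans bij_betw_inv_into)
  have eq: "?f' (f x) = x" if "x \<in> wverts H" for x
    using *(4) that by (simp add: bij_betw_def)
  have "X = star_via (star_via H f G) (?g \<circ> f) K"
    unfolding *(6) star_via_def wverts_mk_wgraph
  proof (rule mk_wgraph_cong)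
    fix e assume "e \<in> [wverts H]\<^bsup>2\<^esup>"
    then have "h ` e = (?g \<circ> f) ` e"
      by (intro image_cong) (auto simp: nsets_def eq subset_iff)
    then show "weight (mk_wgraph (wverts H) (\<lambda>e. weight H e * weight G (f ` e))) e * weight K (h ` e)
       = weight (mk_wgraph (wverts H) (\<lambda>e. weight H e * weight G (f ` e))) e
         * weight K ((?g \<circ> f) ` e)" by simp
  qed
  also have "\<dots> = star_via H f (star_via G ?g K)"
    by (rule star_via_assoc[OF *(4)])
  finally have X: "X = star_via H f (star_via G ?g K)" .
  have "star_via G ?g K \<in> \<G> \<star> \<K>" "bij_betw f (wverts H) (wverts (star_via G ?g K))"
    using * g by (auto intro: starI)
  with X *(1) show "X \<in> \<H> \<star> (\<G> \<star> \<K>)"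
    by (auto intro: starI)
next
  fix X assume "X \<in> \<H> \<star> (\<G> \<star> \<K>)"
  then obtain H f G g K where *: "H \<in> \<H>" "G \<in> \<G>" "K \<in> \<K>" "bij_betw f (wverts H) (wverts G)"
      "bij_betw g (wverts G) (wverts K)" "X = star_via H f (star_via G g K)"
    unfolding star_def by (auto simp: star_via_def)
  have "star_via H f G \<in> \<H> \<star> \<G>" "bij_betw (g \<circ> f) (wverts (star_via H f G)) (wverts K)"
    using * by (auto intro: starI bij_betw_trans)
  then show "X \<in> (\<H> \<star> \<G>) \<star> \<K>"
    unfolding *(6) star_via_assoc[OF *(4), symmetric]
    using *(3) by (blast intro: starI)
qed

lemma star_inf_eqI:
  assumes "m0 \<ge> 1" "\<And>m. m \<ge> m0 \<Longrightarrow> star_power \<G> m = star_power \<G> m0"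
  shows "star_inf \<G> = star_power \<G> m0"
  unfolding star_inf_def
proof (rule the_equality)
  fix \<L> assume "\<exists>m1\<ge>1. \<L> = star_power \<G> m1 \<and>
      (\<forall>m\<ge>m1. star_power \<G> m = star_power \<G> m1)"
  then obtain m1 where "\<L> = star_power \<G> m1" "\<And>m. m \<ge> m1 \<Longrightarrow> star_power \<G> m = star_power \<G> m1"
    by blast
  with assms(2)[of "max m0 m1"] show "\<L> = star_power \<G> m0"
    by (metis max.cobounded1 max.cobounded2)
qed (use assms in blast)

end

theory Submission
  imports Defs
begin

text \<open>
  The polynomial \<open>S[x] + x\<^sup>n E[x]\<close> records a labelling together with its weighted degrees. On the
  pair \<open>{j, k}\<close> it carries \<open>x\<close> to the powers \<open>j - 1\<close>, \<open>k - 1\<close> and \<open>n + \<psi>(j, k)\<close>. Hence, if the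
  edges of \<open>G\<close> carry labels \<open>l\<close> and a bijection \<open>g\<close> numbers the vertices by \<open>1, \<dots>, n\<close>, the total
  weight has as coefficient of \<open>x\<close> to the power \<open>g u - 1\<close> the weighted degree of \<open>u\<close>
  (\<open>coeff_total_weight_low\<close>). As \<open>\<psi>\<close> is injective (\<open>inj_on_edge_index\<close>), the coefficients from
  \<open>x\<^sup>n\<close> on are the individual labels, and \<open>0\<close> elsewhere (\<open>coeff_total_weight_high\<close>, \<open>coeff_total_weight_edge\<close>). So the first
  condition on \<open>p\<close> says that the weighted degrees are different (\<open>inj_on_coeff_iff\<close>), and the second
  one that every number from \<open>1\<close> to \<open>|E(G)|\<close> is a label (\<open>labels_subset_coeff_iff\<close>). There are only
  \<open>|E(G)|\<close> edges, so then the labelling is a bijection.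

  It remains to see which labellings the factor \<open>C(1, \<dots>, k)\<^sub>n\<close> provides. Its weights lie in
  \<open>{1, \<dots>, k}\<close>, which is all that is needed to get an antimagic labelling from \<open>p\<close>. They are not
  arbitrary, though: in a product, the left factor stays in place and only the right factors are
  moved. So every power of \<open>K\<^sub>n \<setminus> e\<close> lacks the edge \<open>e\<close>, and the sums in \<open>C(1, \<dots>, k)\<^sub>n\<close> are exactly
  the weightings that are smallest at \<open>e\<close> (\<open>C_set_eq_minimal_at_removed_edge\<close>). An antimagic labelling
  is nevertheless of this kind after relabelling the vertices: a bijection from \<open>V(G)\<close> that sends the
  edge with label \<open>1\<close> to \<open>e\<close> makes \<open>e\<close> a pair of least weight.
\<close>

section \<open>Powers of a complete graph without an edge\<close>

text \<open>
  The freedom in choosing the bijection of a product: any given edge can be moved onto any other.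
\<close>

lemma bij_betw_extending_subset:
  assumes "finite A" "finite B" "card A = card B" "C \<subseteq> A" "D \<subseteq> B" "card C = card D"
  obtains f where "bij_betw f A B" "f ` C = D"
proof -
  have fin: "finite C" "finite D"
    using assms by (auto intro: finite_subset)
  obtain g where g: "bij_betw g C D"
    using finite_same_card_bij[OF fin assms(6)] by blast
  have "card (A - C) = card (B - D)"
    using assms fin by (simp add: card_Diff_subset)
  then obtain h where h: "bij_betw h (A - C) (B - D)"
    using assms finite_same_card_bij by blast
  let ?f = "\<lambda>x. if x \<in> C then g x else h x"
  have gC: "bij_betw ?f C D"
    using g by (rule bij_betw_cong[THEN iffD1, rotated]) simp
  have "bij_betw ?f (A - C) (B - D)"
    using h by (rule bij_betw_cong[THEN iffD1, rotated]) simp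
  with gC have "bij_betw ?f (C \<union> (A - C)) (D \<union> (B - D))"
    by (rule bij_betw_combine) blast
  moreover have "C \<union> (A - C) = A" "D \<union> (B - D) = B"
    using assms by auto
  ultimately show thesis
    using that[of ?f] bij_betw_imp_surj_on[OF gC] by simp
qed

definition deletion :: "nat \<Rightarrow> nat set set \<Rightarrow> (nat, 'r::comm_ring_1) wgraph" where
  "deletion n F = mk_wgraph {1..n} (\<lambda>d. if d \<in> F then 0 else 1)"

lemma wverts_deletion [simp]: "wverts (deletion n F) = {1..n}"
  by (simp add: deletion_def)

lemma wgraph_of_complete_graph: "wgraph_of (complete_graph n) = deletion n {}"
  by (auto simp: wgraph_of_def complete_graph_def deletion_def intro: mk_wgraph_cong)

lemma wgraph_of_remove_edge: "wgraph_of (remove_edge (complete_graph n) e) = deletion n {e}"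
  by (auto simp: wgraph_of_def complete_graph_def remove_edge_def deletion_def
           intro!: mk_wgraph_cong)

text \<open>
  Weights \<open>0\<close> and \<open>1\<close> multiply like indicator functions, so the edge that \<open>f\<close> sends to \<open>e\<close> is
  deleted in addition to those of \<open>F\<close>.
\<close>

lemma star_via_deletion:
  assumes "bij_betw f {1..n} {1..n}" "d \<in> [{1..n}]\<^bsup>2\<^esup>" "f ` d = e"
  shows "star_via (deletion n F) f (deletion n {e}) = deletion n (insert d F)"
proof -
  have "f ` c = e \<longleftrightarrow> c = d" if "c \<in> [{1..n}]\<^bsup>2\<^esup>" for c
    using assms that inj_on_image_eq_iff[of f "{1..n}" c d]
    by (auto simp: bij_betw_def nsets_def)
  then show ?thesis
    unfolding star_via_def deletion_def wverts_mk_wgraph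
    by (intro mk_wgraph_cong) (simp add: image_in_nsets2[OF assms(1)] del: One_nat_def)
qed

lemma star_deletion:
  assumes "e \<in> [{1..n}]\<^bsup>2\<^esup>"
  shows "deletion n ` X \<star> {deletion n {e}} = {deletion n (insert d F) | d F. d \<in> [{1..n}]\<^bsup>2\<^esup> \<and> F \<in> X}"
    (is "?L = ?R")
proof (intro equalityI subsetI)
  fix H assume "H \<in> ?L"
  then obtain F f where F: "F \<in> X" "bij_betw f {1..n} {1..n}"
    and H: "H = star_via (deletion n F) f (deletion n {e})"
    by (auto simp: star_def)
  let ?d = "inv_into {1..n} f ` e"
  have "?d \<in> [{1..n}]\<^bsup>2\<^esup>"
    using image_in_nsets2[OF bij_betw_inv_into[OF F(2)] assms] .
  moreover have "f ` ?d = e"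
    using F(2) assms by (intro image_inv_into_cancel) (auto simp: bij_betw_def nsets_def)
  ultimately show "H \<in> ?R"
    using F H star_via_deletion by blast
next
  fix H assume "H \<in> ?R"
  then obtain d F where d: "d \<in> [{1..n}]\<^bsup>2\<^esup>" "F \<in> X" and H: "H = deletion n (insert d F)"
    by blast
  obtain f where f: "bij_betw f {1..n} {1..n}" "f ` d = e"
    using bij_betw_extending_subset[of "{1..n}" "{1..n}" d e] d assms
    by (auto simp: nsets_def)
  have "star_via (deletion n F) f (deletion n {e}) \<in> ?L"
    using d f by (intro starI) auto
  then show "H \<in> ?L"
    unfolding H star_via_deletion[OF f(1) d(1) f(2)] .
qed

text \<open>
  The first factor keeps its place, so \<open>e\<close> itself is always deleted. Each further factor deletes
  one more edge of choice, or none if the choice repeats an earlier one.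
\<close>

lemma star_power_deletion:
  assumes "e \<in> [{1..n}]\<^bsup>2\<^esup>"
  shows "star_power {deletion n {e}} (Suc m) =
    deletion n ` {F. e \<in> F \<and> F \<subseteq> [{1..n}]\<^bsup>2\<^esup> \<and> card F \<le> Suc m}"
    (is "star_power {?D {e}} _ = _")
proof -
  have fin: "finite F" if "F \<subseteq> [{1..n}]\<^bsup>2\<^esup>" for F
    using that by (rule finite_subset) (simp add: finite_imp_finite_nsets)
  show ?thesis
  proof (induction m)
    case 0
    have single: "F = {e}" if "e \<in> F" "F \<subseteq> [{1..n}]\<^bsup>2\<^esup>" "card F \<le> Suc 0" for F
      using that card_le_Suc0_iff_eq[OF fin[OF that(2)]] by blast
    have "{F. e \<in> F \<and> F \<subseteq> [{1..n}]\<^bsup>2\<^esup> \<and> card F \<le> Suc 0} \<subseteq> {{e}}"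
      using single by blast
    moreover have "{{e}} \<subseteq> {F. e \<in> F \<and> F \<subseteq> [{1..n}]\<^bsup>2\<^esup> \<and> card F \<le> Suc 0}"
      using assms by simp
    ultimately have "{F. e \<in> F \<and> F \<subseteq> [{1..n}]\<^bsup>2\<^esup> \<and> card F \<le> Suc 0} = {{e}}"
      by (rule equalityI)
    then show ?case
      by (simp add: star_power_def)
  next
    case (Suc m)
    have "star_power {?D {e}} (Suc (Suc m)) =
        star_power {?D {e}} (Suc m) \<star> {?D {e}}"
      by (simp add: star_power_def)
    also have "\<dots> = ?D ` {insert d F | d F. d \<in> [{1..n}]\<^bsup>2\<^esup> \<and>
        e \<in> F \<and> F \<subseteq> [{1..n}]\<^bsup>2\<^esup> \<and> card F \<le> Suc m}"
      unfolding Suc.IH star_deletion[OF assms] by blast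
    also have "{insert d F | d F. d \<in> [{1..n}]\<^bsup>2\<^esup> \<and>
        e \<in> F \<and> F \<subseteq> [{1..n}]\<^bsup>2\<^esup> \<and> card F \<le> Suc m} =
        {F. e \<in> F \<and> F \<subseteq> [{1..n}]\<^bsup>2\<^esup> \<and> card F \<le> Suc (Suc m)}" (is "?L = ?R")
    proof (intro equalityI subsetI)
      fix F assume "F \<in> ?L"
      then show "F \<in> ?R"
        using fin by (auto simp: card_insert_if)
    next
      fix F assume F: "F \<in> ?R"
      show "F \<in> ?L"
      proof (cases "F = {e}")
        case True
        then show ?thesis
          using F assms by (intro CollectI exI[of _ e] exI[of _ "{e}"]) simp
      next
        case False
        then obtain d where d: "d \<in> F" "d \<noteq> e"
          using F by blast
        then have "F = insert d (F - {d})" "card (F - {d}) \<le> Suc m"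
          using F fin by auto
        then show ?thesis
          using d F by (intro CollectI exI[of _ d] exI[of _ "F - {d}"]) auto
      qed
    qed
    finally show ?case .
  qed
qed

text \<open>
  The bound on the number of deleted edges is void as soon as it reaches the number of all pairs,
  and there the powers become stationary.
\<close>

lemma star_inf_deletion:
  assumes "e \<in> [{1..n}]\<^bsup>2\<^esup>"
  shows "star_inf {deletion n {e}} = deletion n ` {F. e \<in> F \<and> F \<subseteq> [{1..n}]\<^bsup>2\<^esup>}"
    (is "star_inf {?D {e}} = _")
proof -
  let ?N = "card ([{1..n}]\<^bsup>2\<^esup>)"
  have *: "star_power {?D {e}} m = ?D ` {F. e \<in> F \<and> F \<subseteq> [{1..n}]\<^bsup>2\<^esup>}"
    if "m \<ge> Suc ?N" for m
  proof -
    obtain k where k: "m = Suc k" "?N \<le> k"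
      using \<open>m \<ge> Suc ?N\<close> by (cases m) auto
    have "card F \<le> Suc k" if "F \<subseteq> [{1..n}]\<^bsup>2\<^esup>" for F
      using card_mono[OF _ that] k by (simp add: finite_imp_finite_nsets)
    then show ?thesis
      unfolding k star_power_deletion[OF assms] by (intro arg_cong[where f="image _"]) blast
  qed
  have stable: "star_power {?D {e}} m = star_power {?D {e}} (Suc ?N)"
    if "m \<ge> Suc ?N" for m
    using *[OF that] *[OF order_refl] by simp
  have "star_inf {?D {e}} = star_power {?D {e}} (Suc ?N)"
    by (rule star_inf_eqI) (simp, rule stable)
  also have "\<dots> = ?D ` {F. e \<in> F \<and> F \<subseteq> [{1..n}]\<^bsup>2\<^esup>}"
    by (rule *) simp
  finally show ?thesis .
qed

section \<open>Weightings that are smallest at the removed edge\<close>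

definition labelled :: "nat \<Rightarrow> (nat set \<Rightarrow> nat) \<Rightarrow> (nat, 'r::comm_ring_1) wgraph" where
  "labelled n w = mk_wgraph {1..n} (\<lambda>d. of_nat (w d))"

lemma wverts_labelled [simp]: "wverts (labelled n w) = {1..n}"
  by (simp add: labelled_def)

lemma wadd_deletion_labelled:
  "wadd (deletion n F) (labelled n w) = labelled n (\<lambda>d. if d \<in> F then w d else Suc (w d))"
  by (auto simp: wadd_def deletion_def labelled_def intro!: mk_wgraph_cong)

lemma wadd_set_deletion_labelled:
  "wadd_set (deletion n ` X) (labelled n ` Y) =
    labelled n ` {\<lambda>d. if d \<in> F then w d else Suc (w d) | F w. F \<in> X \<and> w \<in> Y}"
  (is "?L = ?R")
proof (intro equalityI subsetI)
  fix H assume "H \<in> ?L"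
  then obtain F w where "F \<in> X" "w \<in> Y" "H = wadd (deletion n F) (labelled n w)"
    unfolding wadd_set_def by blast
  then show "H \<in> ?R"
    unfolding wadd_deletion_labelled by blast
next
  fix H assume "H \<in> ?R"
  then obtain F w where F: "F \<in> X" "w \<in> Y" and "H = wadd (deletion n F) (labelled n w)"
    unfolding wadd_deletion_labelled by blast
  then show "H \<in> ?L"
    unfolding wadd_set_def
    by (intro CollectI exI[of _ "deletion n F"] exI[of _ "labelled n w"]) simp
qed

text \<open>
  Each of the \<open>k - 1\<close> variable summands adds \<open>1\<close> outside a set \<open>F\<close> that is empty or contains \<open>e\<close>.
  So \<open>e\<close> gains weight only in those summands in which all pairs do. Conversely, in a weighting that is
  smallest at \<open>e\<close>, the pairs that stay below the top value \<open>k\<close> include \<open>e\<close> if there are any.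
  This makes them an admissible \<open>F\<close>, and removing that summand caps the weights at \<open>k - 1\<close>.
\<close>

lemma C_set_eq_minimal_at_removed_edge:
  assumes "e \<in> [{1..n}]\<^bsup>2\<^esup>"
  shows "(C_set e (Suc m) n :: (nat, 'r::comm_ring_1) wgraph set) =
    labelled n ` {w. \<forall>d\<in>[{1..n}]\<^bsup>2\<^esup>. w d \<in> {1..Suc m} \<and> w e \<le> w d}"
proof (induction m)
  case 0
  let ?W = "{w :: nat set \<Rightarrow> nat. \<forall>d\<in>[{1..n}]\<^bsup>2\<^esup>. w d \<in> {1..Suc 0} \<and> w e \<le> w d}"
  have "labelled n w = (deletion n {} :: (nat, 'r) wgraph)"
    if "\<forall>d\<in>[{1..n}]\<^bsup>2\<^esup>. w d \<in> {1..Suc 0} \<and> w e \<le> w d" for w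
    unfolding labelled_def deletion_def using that by (intro mk_wgraph_cong) auto
  then have "labelled n ` ?W = (\<lambda>_. deletion n {} :: (nat, 'r) wgraph) ` ?W"
    by (intro image_cong[OF refl]) blast
  also have "\<dots> = {deletion n {}}"
    by (rule image_constant[of "\<lambda>_. 1"]) simp
  finally show ?case
    by (simp add: C_set_def wgraph_of_complete_graph)
next
  case (Suc m)
  let ?D = "deletion n :: _ \<Rightarrow> (nat, 'r) wgraph" and ?L = "labelled n :: _ \<Rightarrow> (nat, 'r) wgraph"
  let ?S = "{F. F \<subseteq> [{1..n}]\<^bsup>2\<^esup> \<and> (F = {} \<or> e \<in> F)}"
  have S: "star_inf {?D {e}} \<union> {?D {}} = ?D ` ?S"
    unfolding star_inf_deletion[OF assms] by blast
  have "(C_set e (Suc (Suc m)) n :: (nat, 'r) wgraph set) = wadd_set (?D ` ?S) (C_set e (Suc m) n)"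
    unfolding C_set_def wgraph_of_complete_graph wgraph_of_remove_edge S by simp
  also have "\<dots> = ?L ` {\<lambda>d. if d \<in> F then w d else Suc (w d) | F w.
      F \<in> ?S \<and> (\<forall>d\<in>[{1..n}]\<^bsup>2\<^esup>. w d \<in> {1..Suc m} \<and> w e \<le> w d)}" (is "_ = _ ` ?X")
    unfolding Suc.IH wadd_set_deletion_labelled mem_Collect_eq ..
  also have "\<dots> = ?L ` {w. \<forall>d\<in>[{1..n}]\<^bsup>2\<^esup>. w d \<in> {1..Suc (Suc m)} \<and> w e \<le> w d}"
    (is "_ = _ ` ?Y")
  proof (intro equalityI subsetI)
    fix H assume "H \<in> ?L ` ?X"
    then obtain F w where F: "F \<in> ?S"
      and w: "\<forall>d\<in>[{1..n}]\<^bsup>2\<^esup>. w d \<in> {1..Suc m} \<and> w e \<le> w d"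
      and H: "H = ?L (\<lambda>d. if d \<in> F then w d else Suc (w d))"
      by blast
    have "(\<lambda>d. if d \<in> F then w d else Suc (w d)) \<in> ?Y"
    proof (intro CollectI ballI)
      fix d assume "d \<in> [{1..n}]\<^bsup>2\<^esup>"
      then have "w d \<in> {1..Suc m}" "w e \<le> w d"
        using w by auto
      then show "(if d \<in> F then w d else Suc (w d)) \<in> {1..Suc (Suc m)} \<and>
          (if e \<in> F then w e else Suc (w e)) \<le> (if d \<in> F then w d else Suc (w d))"
        using F by auto
    qed
    then show "H \<in> ?L ` ?Y"
      unfolding H by (rule imageI)
  next
    fix H assume "H \<in> ?L ` ?Y"
    then obtain w where w: "\<forall>d\<in>[{1..n}]\<^bsup>2\<^esup>. w d \<in> {1..Suc (Suc m)} \<and> w e \<le> w d"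
      and H: "H = ?L w" by blast
    \<comment> \<open>If \<open>w\<close> is constantly \<open>m + 2\<close>, then \<open>?F\<close> is empty, and the summand is the complete graph.\<close>
    let ?F = "{d \<in> [{1..n}]\<^bsup>2\<^esup>. w d \<le> Suc m}"
    let ?w = "\<lambda>d. min (w d) (Suc m)"
    have "e \<in> ?F" if "d \<in> ?F" for d
      using that assms w le_trans[of "w e" "w d" "Suc m"] by blast
    then have "?F \<in> ?S"
      by blast
    moreover have "\<forall>d\<in>[{1..n}]\<^bsup>2\<^esup>. ?w d \<in> {1..Suc m} \<and> ?w e \<le> ?w d"
      using w by (auto simp: min_le_iff_disj)
    ultimately have "?L (\<lambda>d. if d \<in> ?F then ?w d else Suc (?w d)) \<in> ?L ` ?X"
      by (intro imageI CollectI exI[of _ ?F] exI[of _ ?w] conjI) (use \<open>?F \<in> ?S\<close> in auto)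
    also have "?L (\<lambda>d. if d \<in> ?F then ?w d else Suc (?w d)) = H"
      unfolding H labelled_def using w
      by (intro mk_wgraph_cong arg_cong[where f=of_nat]) (auto simp: min_def le_Suc_eq)
    finally show "H \<in> ?L ` ?X" .
  qed
  finally show ?case .
qed

section \<open>Coefficients of the total weight\<close>

definition edge_index :: "nat set \<Rightarrow> nat" where
  "edge_index d = psi (Max d) (Min d)"

lemma nsets2_nat_cases:
  assumes "d \<in> [{1..n::nat}]\<^bsup>2\<^esup>"
  obtains j k where "d = {j, k}" "1 \<le> k" "k < j" "j \<le> n" "Max d = j" "Min d = k"
proof -
  obtain j k where "d = {j, k}" "k < j"
    using assms by (auto simp: nsets_def card_2_iff) (metis insert_commute linorder_neqE_nat)
  with assms that[of j k] show thesis
    by (auto simp: nsets_def max_def min_def)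
qed

text \<open>
  The exponents \<open>\<psi>(j, 1), \<dots>, \<psi>(j, j - 1)\<close> fill the interval from \<open>(j - 1) choose 2\<close> up to, but
  excluding, \<open>j choose 2\<close>. The intervals for different \<open>j\<close> are therefore disjoint and increasing.
\<close>

lemma psi_less:
  assumes "k < j" "j < j'" "1 \<le> k" "1 \<le> k'"
  shows "psi j k < psi j' k'"
proof -
  have "psi j k < ((j - 1) choose 2) + (j - 1)"
    using assms by (simp add: psi_def)
  also have "\<dots> = j choose 2"
    using assms by (cases j) (auto simp: numeral_2_eq_2)
  also have "\<dots> \<le> (j' - 1) choose 2"
    using assms by (intro binomial_right_mono) auto
  also have "\<dots> \<le> psi j' k'"
    using assms by (simp add: psi_def)
  finally show ?thesis .
qed

lemma inj_on_edge_index: "inj_on edge_index ([{1..n}]\<^bsup>2\<^esup>)"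
proof (rule inj_onI)
  fix c d assume "c \<in> [{1..n}]\<^bsup>2\<^esup>" "d \<in> [{1..n}]\<^bsup>2\<^esup>" and eq: "edge_index c = edge_index d"
  then obtain j k j' k' where c: "c = {j, k}" "1 \<le> k" "k < j" "Max c = j" "Min c = k"
    and d: "d = {j', k'}" "1 \<le> k'" "k' < j'" "Max d = j'" "Min d = k'"
    by (metis nsets2_nat_cases)
  have eq': "psi j k = psi j' k'"
    using eq c d by (simp add: edge_index_def)
  then have "j = j'"
    using psi_less[of k j j' k'] psi_less[of k' j' j k] c d by (metis less_irrefl linorder_neqE_nat)
  moreover have "k = k'"
    using eq' c(2) d(2) \<open>j = j'\<close> by (simp add: psi_def)
  ultimately show "c = d"
    unfolding c(1) d(1) by simp
qed

text \<open>The graph \<open>S[x] + x\<^sup>n E[x]\<close>, whose powers of \<open>x\<close> trace labels to vertices and edges.\<close>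

abbreviation tracer :: "nat \<Rightarrow> (nat, real poly) wgraph" where
  "tracer n \<equiv> wadd (S_poly n) (wscale (monom 1 n) (E_poly n))"

lemma wverts_tracer [simp]: "wverts (tracer n) = {1..n}"
  by (simp add: wadd_def S_poly_def wsum_def)

lemma weight_S_poly:
  assumes "d \<in> [{1..n}]\<^bsup>2\<^esup>"
  shows "weight (S_poly n) d = (\<Sum>j\<in>d. monom 1 (j - 1))"
proof -
  have "weight (S_poly n) d = (\<Sum>j=1..n. if j \<in> d then monom 1 (j - 1) else 0)"
    unfolding S_poly_def wsum_def weight_mk_wgraph[OF assms]
  proof (rule sum.cong)
    fix j assume "j \<in> {1..n}"
    have "d \<in> {{j, k} | k. k \<in> {1..n} \<and> k \<noteq> j} \<longleftrightarrow> j \<in> d"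
      using assms \<open>j \<in> {1..n}\<close> by (auto simp: nsets_def card_2_iff doubleton_eq_iff)
    then show "weight (wscale (monom 1 (j - 1)) (wgraph_of (star_graph n j))) d =
        (if j \<in> d then monom 1 (j - 1) else 0 :: real poly)"
      using assms by (simp add: wscale_def wgraph_of_def star_graph_def)
  qed simp
  also have "\<dots> = (\<Sum>j\<in>{1..n} \<inter> d. monom 1 (j - 1))"
    by (rule sum.inter_restrict[symmetric]) simp
  also have "{1..n} \<inter> d = d"
    using assms by (auto simp: nsets_def)
  finally show ?thesis .
qed

lemma weight_E_poly:
  assumes "d \<in> [{1..n}]\<^bsup>2\<^esup>"
  shows "weight (E_poly n) d = monom 1 (edge_index d)"
proof -
  obtain j k where d: "d = {j, k}" "1 \<le> k" "k < j" "j \<le> n" "Max d = j" "Min d = k"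
    using nsets2_nat_cases[OF assms] .
  let ?I = "{(j, k). 1 \<le> k \<and> k < j \<and> j \<le> n}"
  have "finite ?I"
    by (rule finite_subset[of _ "{1..n} \<times> {1..n}"]) auto
  have "weight (E_poly n) d = (\<Sum>p\<in>?I. if p = (j, k) then monom 1 (psi j k) else 0)"
    unfolding E_poly_def wsum_def weight_mk_wgraph[OF assms]
  proof (rule sum.cong)
    fix p assume "p \<in> ?I"
    then show "weight (case p of (j, k) \<Rightarrow> wscale (monom 1 (psi j k)) (wgraph_of (edge_graph n j k))) d
        = (if p = (j, k) then monom 1 (psi j k) else 0 :: real poly)"
      using assms d(1-4)
      by (auto simp: wscale_def wgraph_of_def edge_graph_def doubleton_eq_iff split: if_splits)
  qed simp
  also have "\<dots> = monom 1 (psi j k)"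
    using \<open>finite ?I\<close> d by (simp add: sum.delta)
  finally show ?thesis
    by (simp add: edge_index_def d)
qed

lemma weight_tracer:
  assumes "d \<in> [{1..n}]\<^bsup>2\<^esup>"
  shows "weight (tracer n) d = (\<Sum>j\<in>d. monom 1 (j - 1)) + monom 1 (n + edge_index d)"
proof -
  have "wverts (S_poly n) = {1..n}" "wverts (E_poly n) = {1..n}"
    by (simp_all add: S_poly_def E_poly_def wsum_def)
  then show ?thesis
    using assms weight_S_poly[OF assms] weight_E_poly[OF assms]
    by (simp add: wadd_def wscale_def mult_monom del: One_nat_def)
qed

lemma coeff_tracer_low:
  assumes "d \<in> [{1..n}]\<^bsup>2\<^esup>" "i < n"
  shows "coeff (weight (tracer n) d) i = of_bool (Suc i \<in> d)"
proof -
  have fin: "finite d" and d: "d \<subseteq> {1..n}"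
    using assms by (auto simp: nsets_def)
  have "(\<Sum>j\<in>d. coeff (monom 1 (j - 1)) i) = (\<Sum>j\<in>d. if Suc i = j then 1 else 0 :: real)"
    using d by (intro sum.cong) auto
  then show ?thesis
    using assms(2) fin by (simp add: weight_tracer[OF assms(1)] coeff_sum)
qed

lemma coeff_tracer_high:
  assumes "d \<in> [{1..n}]\<^bsup>2\<^esup>" "i \<ge> n"
  shows "coeff (weight (tracer n) d) i = of_bool (i = n + edge_index d)"
proof -
  have d: "d \<subseteq> {1..n}"
    using assms by (auto simp: nsets_def)
  have "(\<Sum>j\<in>d. coeff (monom 1 (j - 1)) i) = (0 :: real)"
  proof (intro sum.neutral ballI)
    fix j assume "j \<in> d"
    then have "j - 1 \<noteq> i"
      using d assms(2) by fastforce
    then show "coeff (monom 1 (j - 1)) i = (0 :: real)"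
      by simp
  qed
  then show ?thesis
    by (auto simp: weight_tracer[OF assms(1)] coeff_sum)
qed

lemma finite_edges:
  assumes "simple_graph G"
  shows "finite (edges G)"
proof (rule finite_subset)
  show "edges G \<subseteq> [verts G]\<^bsup>2\<^esup>"
    using assms by (simp add: simple_graph_def)
  show "finite ([verts G]\<^bsup>2\<^esup>)"
    using assms by (simp add: simple_graph_def finite_imp_finite_nsets)
qed

context
  fixes G :: "'a graph" and n :: nat and f g :: "'a \<Rightarrow> nat" and w :: "nat set \<Rightarrow> nat"
    and l :: "'a set \<Rightarrow> nat" and p :: "real poly"
  assumes G: "simple_graph G"
    and f: "bij_betw f (verts G) {1..n}" and g: "bij_betw g (verts G) {1..n}"
  defines "l \<equiv> \<lambda>d. w (f ` d)"
    and "p \<equiv> total_weight (star_via (star_via (wgraph_of G) f (labelled n w)) g (tracer n))"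
begin

lemma coeff_total_weight: "coeff p i = (\<Sum>d\<in>edges G. l d * coeff (weight (tracer n) (g ` d)) i)"
proof -
  have E: "edges G \<subseteq> [verts G]\<^bsup>2\<^esup>" "finite ([verts G]\<^bsup>2\<^esup>)"
    using G by (auto simp: simple_graph_def finite_imp_finite_nsets)
  have "p = (\<Sum>d\<in>[verts G]\<^bsup>2\<^esup>. (if d \<in> edges G then of_nat (l d) else 0) * weight (tracer n) (g ` d))"
    unfolding p_def total_weight_def
  proof (rule sum.cong)
    fix d assume d: "d \<in> [verts G]\<^bsup>2\<^esup>"
    have "weight (labelled n w) (f ` d) = (of_nat (l d) :: real poly)"
      unfolding labelled_def l_def by (rule weight_mk_wgraph) (rule image_in_nsets2[OF f d])
    then show "weight (star_via (star_via (wgraph_of G) f (labelled n w)) g (tracer n)) d =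
        (if d \<in> edges G then of_nat (l d) else 0) * weight (tracer n) (g ` d)"
      using d by (simp add: star_via_def wgraph_of_def)
  qed (simp add: wgraph_of_def)
  also have "\<dots> = (\<Sum>d\<in>edges G. of_nat (l d) * weight (tracer n) (g ` d))"
    using E by (intro sum.mono_neutral_cong_right) auto
  finally show ?thesis
    by (simp add: coeff_sum of_nat_poly)
qed

text \<open>
  The exponent \<open>g u - 1\<close> occurs on exactly the pairs that contain \<open>g u\<close>, so the labels of the edges
  at \<open>u\<close> are summed up.
\<close>

lemma coeff_total_weight_low:
  assumes "u \<in> verts G"
  shows "coeff p (g u - 1) = weighted_degree G l u"
proof -
  have "g u \<in> {1..n}"
    using assms g by (auto simp: bij_betw_def)
  then have gu: "g u - 1 < n" "Suc (g u - 1) = g u"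
    by auto
  have "coeff p (g u - 1) = (\<Sum>d\<in>edges G. if u \<in> d then real (l d) else 0)"
    unfolding coeff_total_weight
  proof (rule sum.cong)
    fix d assume "d \<in> edges G"
    then have d: "d \<in> [verts G]\<^bsup>2\<^esup>"
      using G by (auto simp: simple_graph_def)
    have "g u \<in> g ` d \<longleftrightarrow> u \<in> d"
      using d g assms by (intro inj_on_image_mem_iff[of g "verts G"]) (auto simp: bij_betw_def nsets_def)
    then show "l d * coeff (weight (tracer n) (g ` d)) (g u - 1) = (if u \<in> d then real (l d) else 0)"
      unfolding coeff_tracer_low[OF image_in_nsets2[OF g d] gu(1)] gu(2) by simp
  qed simp
  also have "\<dots> = weighted_degree G l u"
    unfolding weighted_degree_def of_nat_sum using finite_edges[OF G] by (simp add: sum.inter_filter)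
  finally show ?thesis .
qed

lemma coeff_total_weight_high:
  assumes "i \<ge> n"
  shows "coeff p i = (\<Sum>d | d \<in> edges G \<and> i = n + edge_index (g ` d). real (l d))"
proof -
  have "coeff p i = (\<Sum>d\<in>edges G. if i = n + edge_index (g ` d) then real (l d) else 0)"
    unfolding coeff_total_weight
  proof (rule sum.cong)
    fix d assume "d \<in> edges G"
    then have d: "d \<in> [verts G]\<^bsup>2\<^esup>"
      using G by (auto simp: simple_graph_def)
    show "l d * coeff (weight (tracer n) (g ` d)) i = (if i = n + edge_index (g ` d) then real (l d) else 0)"
      using assms by (simp add: coeff_tracer_high[OF image_in_nsets2[OF g d]])
  qed simp
  then show ?thesis
    using finite_edges[OF G] by (simp add: sum.inter_filter)
qed

lemma inj_on_edge_exponent: "inj_on (\<lambda>d. n + edge_index (g ` d)) (edges G)"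
proof (rule inj_onI)
  fix c d assume "c \<in> edges G" "d \<in> edges G" and eq: "n + edge_index (g ` c) = n + edge_index (g ` d)"
  then have cd: "c \<in> [verts G]\<^bsup>2\<^esup>" "d \<in> [verts G]\<^bsup>2\<^esup>"
    using G by (auto simp: simple_graph_def)
  have "g ` c = g ` d"
    using eq by (intro inj_onD[OF inj_on_edge_index[of n]] image_in_nsets2[OF g] cd) simp
  then show "c = d"
    using cd g inj_on_image_eq_iff[of g "verts G" c d] by (auto simp: bij_betw_def nsets_def)
qed

text \<open>No two edges share an exponent from \<open>n\<close> on, so a label can be read off unmixed.\<close>

lemma coeff_total_weight_edge:
  assumes "d \<in> edges G"
  shows "coeff p (n + edge_index (g ` d)) = l d"
proof -
  have "{c. c \<in> edges G \<and> n + edge_index (g ` d) = n + edge_index (g ` c)} = {d}"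
    using assms inj_onD[OF inj_on_edge_exponent] by blast
  then show ?thesis
    by (simp only: coeff_total_weight_high[OF le_add1]) simp
qed

lemma inj_on_coeff_iff:
  assumes "n > 0"
  shows "inj_on (coeff p) {0..n - 1} \<longleftrightarrow> inj_on (weighted_degree G l) (verts G)"
proof -
  have "bij_betw (\<lambda>j. j - 1) {1..n} {0..n - 1}"
    using assms by (intro bij_betwI[of _ _ _ Suc]) auto
  with g have "bij_betw ((\<lambda>j. j - 1) \<circ> g) (verts G) {0..n - 1}"
    by (rule bij_betw_trans)
  then have h: "inj_on ((\<lambda>j. j - 1) \<circ> g) (verts G)" "((\<lambda>j. j - 1) \<circ> g) ` verts G = {0..n - 1}"
    by (auto simp: bij_betw_def)
  have "inj_on (coeff p) {0..n - 1} \<longleftrightarrow> inj_on (coeff p \<circ> ((\<lambda>j. j - 1) \<circ> g)) (verts G)"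
    using comp_inj_on_iff[OF h(1), of "coeff p"] h(2) by simp
  also have "\<dots> \<longleftrightarrow> inj_on (\<lambda>u. real (weighted_degree G l u)) (verts G)"
    unfolding comp_def by (rule inj_on_cong) (rule coeff_total_weight_low)
  also have "\<dots> \<longleftrightarrow> inj_on (weighted_degree G l) (verts G)"
    by (simp add: inj_on_def)
  finally show ?thesis .
qed

text \<open>
  Exponents that belong to no edge have coefficient \<open>0\<close>. They cannot contribute to \<open>{1..m}\<close>.
\<close>

lemma labels_subset_coeff_iff:
  assumes "n > 0"
  shows "real ` {1..m} \<subseteq> coeff p ` (- {0..n - 1}) \<longleftrightarrow> {1..m} \<subseteq> l ` edges G"
proof
  assume R: "{1..m} \<subseteq> l ` edges G"
  show "real ` {1..m} \<subseteq> coeff p ` (- {0..n - 1})"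
  proof
    fix x assume "x \<in> real ` {1..m}"
    then obtain d where d: "d \<in> edges G" "x = real (l d)"
      using R by auto
    then have "x = coeff p (n + edge_index (g ` d))"
      by (simp add: coeff_total_weight_edge)
    moreover have "n + edge_index (g ` d) \<in> - {0..n - 1}"
      using assms by auto
    ultimately show "x \<in> coeff p ` (- {0..n - 1})"
      by (rule image_eqI)
  qed
next
  assume L: "real ` {1..m} \<subseteq> coeff p ` (- {0..n - 1})"
  show "{1..m} \<subseteq> l ` edges G"
  proof
    fix c assume c: "c \<in> {1..m}"
    then obtain i where i: "i \<notin> {0..n - 1}" "real c = coeff p i"
      using L by blast
    then have "i \<ge> n" by auto
    have "\<exists>d\<in>edges G. i = n + edge_index (g ` d)"
    proof (rule ccontr)
      assume "\<not> ?thesis"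
      then have "{d. d \<in> edges G \<and> i = n + edge_index (g ` d)} = {}"
        by blast
      then have "coeff p i = 0"
        unfolding coeff_total_weight_high[OF \<open>i \<ge> n\<close>] by (simp only: sum.empty)
      then show False
        using i c by simp
    qed
    then obtain d where "d \<in> edges G" "i = n + edge_index (g ` d)" by blast
    then show "c \<in> l ` edges G"
      using i coeff_total_weight_edge by auto
  qed
qed

end

section \<open>Antimagic labellings\<close>

theorem theorem2p5:
  fixes G :: "'a graph" and n :: nat and e :: "nat set"
  assumes "simple_graph G"
    and "no_isolated_verts G"
    and "n = card (verts G)"
    and "e \<in> edges (complete_graph n)"
  shows "antimagic G \<longleftrightarrow>
    (\<exists>p \<in> total_weight ` ({wgraph_of G} \<star> C_set e (card (edges G)) n
            \<star> {wadd (S_poly n) (wscale (monom 1 n) (E_poly n))}).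
       inj_on (coeff p) {0..n - 1} \<and>
       real ` {1..card (edges G)} \<subseteq> coeff p ` (- {0..n - 1}))"
proof -
  have V: "finite (verts G)" "verts G \<noteq> {}" and E: "edges G \<subseteq> [verts G]\<^bsup>2\<^esup>"
    using assms(1) by (auto simp: simple_graph_def)
  have finE: "finite (edges G)"
    using assms(1) by (rule finite_edges)
  have "edges G \<noteq> {}"
    using V assms(2) by (auto simp: no_isolated_verts_def)
  then obtain m where m: "card (edges G) = Suc m"
    using finE by (metis card_eq_0_iff not0_implies_Suc)
  have e: "e \<in> [{1..n}]\<^bsup>2\<^esup>"
    using assms(4) by (simp add: complete_graph_def)
  have n: "n > 0"
    using V assms(3) by (simp add: card_gt_0_iff)
  let ?p = "\<lambda>f g w. total_weight (star_via (star_via (wgraph_of G) f (labelled n w)) g (tracer n))"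
  have wv: "wverts (wgraph_of G) = verts G"
    by (simp add: wgraph_of_def)
  define W where "W = {w. \<forall>d\<in>[{1..n}]\<^bsup>2\<^esup>. w d \<in> {1..Suc m} \<and> w e \<le> w d}"
  let ?R = "{?p f g w | f g w. bij_betw f (verts G) {1..n} \<and> bij_betw g (verts G) {1..n} \<and> w \<in> W}"
  have set_eq: "total_weight ` ({wgraph_of G} \<star> C_set e (card (edges G)) n \<star> {tracer n}) = ?R"
    unfolding m C_set_eq_minimal_at_removed_edge[OF e, of m, folded W_def]
  proof (intro equalityI subsetI)
    fix p assume "p \<in> total_weight ` ({wgraph_of G} \<star> labelled n ` W \<star> {tracer n})"
    then obtain H g where H: "H \<in> {wgraph_of G} \<star> labelled n ` W"
      and g: "bij_betw g (wverts H) (wverts (tracer n))" and p: "p = total_weight (star_via H g (tracer n))"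
      unfolding star_def[of _ "{tracer n}"] by blast
    from H obtain H' f L where "H' \<in> {wgraph_of G}" and L: "L \<in> labelled n ` W"
      and "bij_betw f (wverts H') (wverts L)" "H = star_via H' f L"
      unfolding star_def by blast
    then have f: "bij_betw f (verts G) (wverts L)" "H = star_via (wgraph_of G) f L"
      by (simp_all add: wv)
    from L obtain w where "w \<in> W" "L = labelled n w"
      by blast
    with f have "bij_betw f (verts G) {1..n}"
        "H = star_via (wgraph_of G) f (labelled n w)"
      by simp_all
    moreover from this g have "bij_betw g (verts G) {1..n}"
      by (simp add: wv)
    ultimately show "p \<in> ?R"
      using \<open>w \<in> W\<close> unfolding p wv by blast
  next
    fix p assume "p \<in> ?R"
    then obtain f g w where fg: "bij_betw f (verts G) {1..n}" "bij_betw g (verts G) {1..n}"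
      and w: "w \<in> W" and p: "p = ?p f g w"
      by blast
    have "star_via (wgraph_of G) f (labelled n w) \<in> {wgraph_of G} \<star> labelled n ` W"
      using fg w by (intro starI imageI) (simp_all add: wv)
    then show "p \<in> total_weight ` ({wgraph_of G} \<star> labelled n ` W \<star> {tracer n})"
      unfolding p using fg w by (intro imageI starI) (simp_all add: wv)
  qed
  show ?thesis
    unfolding set_eq
  proof
    assume "antimagic G"
    then obtain l where l: "bij_betw l (edges G) {1..Suc m}" "inj_on (weighted_degree G l) (verts G)"
      by (auto simp: antimagic_def m)
    \<comment> \<open>Among the edges, only one of least label may be moved onto \<open>e\<close>.\<close>
    obtain d0 where d0: "d0 \<in> edges G" "l d0 = 1"
      using l(1) by (metis atLeastAtMost_iff bij_betw_def imageE le_refl le_add1 plus_1_eq_Suc)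
    have sub: "d0 \<subseteq> verts G" "e \<subseteq> {1..n}" "card d0 = card e"
      using d0 E e by (auto simp: nsets_def)
    have "card (verts G) = card {1..n}"
      using assms(3) by simp
    with V(1) finite_atLeastAtMost obtain f where f: "bij_betw f (verts G) {1..n}" "f ` d0 = e"
      using sub by (rule bij_betw_extending_subset)
    let ?inv = "\<lambda>c. inv_into (verts G) f ` c"
    \<comment> \<open>Non-edges of \<open>G\<close> have weight \<open>0\<close> in the product. The value \<open>1\<close> given to their images is a
      dummy within the range that \<open>W\<close> requires.\<close>
    define w where "w = (\<lambda>c. if ?inv c \<in> edges G then l (?inv c) else 1)"
    have inv: "?inv (f ` d) = d" if "d \<in> edges G" for d
    proof (rule inv_into_image_cancel)
      show "inj_on f (verts G)"
        using f(1) by (rule bij_betw_imp_inj_on)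
      show "d \<subseteq> verts G"
        using that E by (auto simp: nsets_def)
    qed
    have wl: "w (f ` d) = l d" if "d \<in> edges G" for d
      using that by (simp add: w_def inv)
    have "w d \<in> {1..Suc m}" for d
      using l(1) by (auto simp: w_def bij_betw_def)
    moreover have "w e = 1"
      using wl[OF d0(1)] d0 f by simp
    ultimately have "w \<in> W"
      by (simp add: W_def)
    have "weighted_degree G (\<lambda>d. w (f ` d)) = weighted_degree G l"
      unfolding weighted_degree_def by (intro ext sum.cong) (simp_all add: wl)
    with l(2) have "inj_on (coeff (?p f f w)) {0..n - 1}"
      unfolding inj_on_coeff_iff[OF assms(1) f(1) f(1) n] by simp
    moreover have "(\<lambda>d. w (f ` d)) ` edges G = l ` edges G"
      by (rule image_cong) (simp_all add: wl)
    with l(1) have "real ` {1..Suc m} \<subseteq> coeff (?p f f w) ` (- {0..n - 1})"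
      unfolding labels_subset_coeff_iff[OF assms(1) f(1) f(1) n] by (simp add: bij_betw_def)
    moreover have "?p f f w \<in> ?R"
      using f(1) \<open>w \<in> W\<close> by blast
    ultimately show "\<exists>p\<in>?R. inj_on (coeff p) {0..n - 1} \<and>
        real ` {1..card (edges G)} \<subseteq> coeff p ` (- {0..n - 1})"
      unfolding m by (intro bexI[of _ "?p f f w"] conjI)
  next
    assume "\<exists>p\<in>?R.
       inj_on (coeff p) {0..n - 1} \<and>
       real ` {1..card (edges G)} \<subseteq> coeff p ` (- {0..n - 1})"
    then obtain p where "p \<in> ?R" and p: "inj_on (coeff p) {0..n - 1}"
        "real ` {1..Suc m} \<subseteq> coeff p ` (- {0..n - 1})"
      unfolding m by (elim bexE conjE)
    then obtain f g w where f: "bij_betw f (verts G) {1..n}" and g: "bij_betw g (verts G) {1..n}"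
      and w: "w \<in> W" and inj: "inj_on (coeff (?p f g w)) {0..n - 1}"
      and sub: "real ` {1..Suc m} \<subseteq> coeff (?p f g w) ` (- {0..n - 1})"
      by blast
    let ?l = "\<lambda>d. w (f ` d)"
    have "?l ` edges G \<subseteq> {1..Suc m}"
    proof (rule image_subsetI)
      fix d assume "d \<in> edges G"
      then have "f ` d \<in> [{1..n}]\<^bsup>2\<^esup>"
        using E by (intro image_in_nsets2[OF f]) blast
      then show "w (f ` d) \<in> {1..Suc m}"
        using w unfolding W_def by blast
    qed
    moreover have "{1..Suc m} \<subseteq> ?l ` edges G"
      using sub unfolding labels_subset_coeff_iff[OF assms(1) f g n] .
    ultimately have surj: "?l ` edges G = {1..Suc m}"
      by blast
    then have "inj_on ?l (edges G)"
      using finE m by (intro eq_card_imp_inj_on) simp_all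
    then show "antimagic G"
      using surj inj unfolding antimagic_def m inj_on_coeff_iff[OF assms(1) f g n]
      by (intro exI[of _ ?l]) (simp add: bij_betw_def)
  qed
qed

end
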